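(* Let $p_n$ denote the $n$-th prime and $\mathbb{P}$ the set of all primes. For $J\subseteq\mathbb{P}$ put $\mathbb{P}_J=\{p_n\mid n\in J\}$. Define $P^{(1)}=\mathbb{P}$ and $P^{(k)}=\mathbb{P}_{P^{(k-1)}}$ for $k\ge 2$ (so $P^{(2)}=\{p_{p_n}\}$ are the prime-indexed primes, $P^{(3)}=\{p_{p_{p_n}}\}$, etc.). Let $\mathbb{P}'$ be the unique subset $I\subseteq\mathbb{P}$ satisfying $\mathbb{P}=I\cup\mathbb{P}_I$ and $I\cap\mathbb{P}_I=\emptyset$. Then \[ \mathbb{P}'=P^{(1)}-P^{(2)}+P^{(3)}-P^{(4)}+\cdots, \] where the right-hand side is the set of primes $p$ such that the largest $k\ge1$ with $p\in P^{(k)}$ is odd (equivalently, the number of $k\ge1$ with $p\in P^{(k)}$ is odd).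
   Context: In the paper the alternating expression $P^{(1)}-P^{(2)}+P^{(3)}-\cdots$ is a formal alternating union/set difference of the nested sets $P^{(1)}\supseteq P^{(2)}\supseteq P^{(3)}\supseteq\cdots$, evaluated prime by prime: a prime $p$ lies in the result exactly when the last (largest) $k$ with $p\in P^{(k)}$ carries a plus sign, i.e. is odd. Each prime lies in only finitely many $P^{(k)}$. The existence and uniqueness of the set $I$ used to define $\mathbb{P}'$ is a separate result. *)

theory Defs
  imports "HOL-Computational_Algebra.Primes" "HOL-Library.Infinite_Set"
begin

abbreviation primes :: "nat set" where
  "primes \<equiv> {p. prime p}"

(* The n-th prime for n >= 1, with p_1 = 2: enumerate counts from 0.
   The value at n = 0 is junk; every index used below is a prime. *)
definition nth_prime :: "nat \<Rightarrow> nat" where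
  "nth_prime n = enumerate primes (n - 1)"

definition primes_indexed_by :: "nat set \<Rightarrow> nat set" where
  "primes_indexed_by J = {nth_prime n | n. n \<in> J}"

(* P^(k); only k >= 1 is meaningful. *)
fun iterated_primes :: "nat \<Rightarrow> nat set" where
  "iterated_primes 0 = {}"
| "iterated_primes (Suc 0) = primes"
| "iterated_primes (Suc (Suc k)) = primes_indexed_by (iterated_primes (Suc k))"

definition primes_prime :: "nat set" where
  "primes_prime = (THE I. I \<subseteq> primes \<and> primes = I \<union> primes_indexed_by I
                          \<and> I \<inter> primes_indexed_by I = {})"

(* A 1 - A 2 + A 3 - A 4 + ... for nested sets A 1, A 2, ..., evaluated pointwise:
   x belongs iff there is a largest k >= 1 with x in A k, and that k is odd. *)
definition alternating_union :: "(nat \<Rightarrow> 'a set) \<Rightarrow> 'a set" where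
  "alternating_union A =
     {x. \<exists>k\<ge>1. odd k \<and> x \<in> A k \<and> (\<forall>j\<ge>1. x \<in> A j \<longrightarrow> j \<le> k)}"

end

(* Write f for n \<mapsto> p_n. Since f is injective with f n > n, every prime is reached from a unique
   prime outside the image of f by finitely many applications of f. The set of levels k with p \<in> P^(k)
   is {1} if p is not in the image of f, and p \<mapsto> f p shifts it by one and adds 1; so it is an initial
   segment {1..d} whose length changes parity under f. A set I of primes satisfies the defining conditions
   of P' exactly when, for all primes p, p \<in> I iff p is not f q for some q \<in> I; by descent along f
   this has the set of primes with d odd as its only solution. *)
theory Submission
  imports Defs
begin

lemma prime_nth_prime: "prime (nth_prime n)"
  unfolding nth_prime_def using enumerate_in_set[OF primes_infinite] by blast

text \<open>Truncated subtraction gives \<open>nth_prime 0 = nth_prime 1\<close>; primes are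
  positive, so on them the shift by one is injective.\<close>

lemma inj_on_nth_prime: "inj_on nth_prime primes"
proof (rule inj_onI)
  fix m n :: nat
  assume "m \<in> primes" "n \<in> primes" and eq: "nth_prime m = nth_prime n"
  then have "m > 0" "n > 0" by (auto simp: prime_gt_0_nat)
  moreover have "m - 1 = n - 1"
    using eq inj_enumerate[OF primes_infinite] unfolding nth_prime_def by (auto dest: injD)
  ultimately show "m = n" by simp
qed

text \<open>Makes descent along \<open>nth_prime\<close> well-founded. The enumeration starts at 2
  and increases strictly, so it exceeds its zero-based index by at least 2, which absorbs the
  shift.\<close>

lemma less_nth_prime: "n < nth_prime n"
proof -
  have "m + 2 \<le> enumerate primes m" for m
  proof (induction m)
    case 0
    have "prime (enumerate primes 0)"
      using enumerate_in_set[OF primes_infinite] by blast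
    then show ?case by (metis add_0 prime_ge_2_nat)
  next
    case (Suc m)
    have "enumerate primes m < enumerate primes (Suc m)"
      using enumerate_step[OF primes_infinite] .
    with Suc show ?case by linarith
  qed
  from this[of "n - 1"] show ?thesis unfolding nth_prime_def by linarith
qed

lemma primes_indexed_by_image: "primes_indexed_by J = nth_prime ` J"
  unfolding primes_indexed_by_def by blast

lemma iterated_primes_subset: "iterated_primes k \<subseteq> primes"
  by (induction k rule: iterated_primes.induct)
     (auto simp: primes_indexed_by_image prime_nth_prime)

definition levels :: "nat \<Rightarrow> nat set" where
  "levels p = {k. k \<ge> 1 \<and> p \<in> iterated_primes k}"

lemma levels_not_indexed:
  assumes "prime p" "p \<notin> nth_prime ` primes"
  shows "levels p = {1}"
proof -
  have "k \<in> levels p \<longleftrightarrow> k = 1" for k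
    using assms iterated_primes_subset
    by (cases k rule: iterated_primes.cases) (auto simp: levels_def primes_indexed_by_image)
  then show ?thesis by blast
qed

text \<open>Injectivity cancels \<open>nth_prime\<close>, so level k of \<open>p\<close> becomes
  level k + 1; level 1 is new because \<open>nth_prime p\<close> is prime.\<close>

lemma levels_nth_prime:
  assumes "prime p"
  shows "levels (nth_prime p) = insert 1 (Suc ` levels p)"
proof -
  have "nth_prime p \<in> nth_prime ` iterated_primes k \<longleftrightarrow> p \<in> iterated_primes k" for k
    using assms iterated_primes_subset inj_on_image_mem_iff[OF inj_on_nth_prime] by simp
  then have "k \<in> levels (nth_prime p) \<longleftrightarrow> k \<in> insert 1 (Suc ` levels p)" for k
    by (cases k rule: iterated_primes.cases)
       (auto simp: levels_def primes_indexed_by_image prime_nth_prime)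
  then show ?thesis by blast
qed

lemma levels_initial_segment:
  assumes "prime p"
  shows "\<exists>d\<ge>1. levels p = {1..d}"
  using assms
proof (induction p rule: less_induct)
  case (less p)
  show ?case
  proof (cases "p \<in> nth_prime ` primes")
    case False
    with less.prems have "levels p = {1..1}" using levels_not_indexed by simp
    then show ?thesis by blast
  next
    case True
    then obtain q where q: "prime q" "p = nth_prime q" by blast
    then obtain d where "levels q = {1..d}" using less.IH less_nth_prime by blast
    with q have "levels p = {1..Suc d}"
      using levels_nth_prime by (auto simp: image_Suc_atLeastAtMost)
    then show ?thesis by (metis le_add1 plus_1_eq_Suc)
  qed
qed

lemma odd_card_levels_nth_prime:
  assumes "prime p"
  shows "odd (card (levels (nth_prime p))) \<longleftrightarrow> even (card (levels p))"
proof -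
  have "finite (levels p)" using levels_initial_segment[OF assms] by auto
  \<comment> \<open>Levels start at 1, so shifted ones start at 2 and the inserted 1 raises the
    cardinality by exactly one.\<close>
  moreover have "1 \<notin> Suc ` levels p" by (auto simp: levels_def)
  ultimately show ?thesis
    by (simp add: levels_nth_prime[OF assms] card_image)
qed

definition odd_level_primes :: "nat set" where
  "odd_level_primes = {p \<in> primes. odd (card (levels p))}"

lemma odd_level_primes_iff:
  assumes "prime p"
  shows "p \<in> odd_level_primes \<longleftrightarrow> p \<notin> nth_prime ` odd_level_primes"
proof (cases "p \<in> nth_prime ` primes")
  case False
  then show ?thesis
    using assms levels_not_indexed by (auto simp: odd_level_primes_def)
next
  case True
  then obtain q where q: "prime q" "p = nth_prime q" by blast
  then have "p \<in> nth_prime ` odd_level_primes \<longleftrightarrow> q \<in> odd_level_primes"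
    using inj_on_image_mem_iff[OF inj_on_nth_prime, of q odd_level_primes]
    by (auto simp: odd_level_primes_def)
  then show ?thesis
    using q odd_card_levels_nth_prime[of q]
    by (auto simp: odd_level_primes_def prime_nth_prime)
qed

text \<open>Since \<open>nth_prime q > q\<close>, membership of \<open>p\<close> in the image of a
  set depends only on the elements below \<open>p\<close>; strong induction applies.\<close>

lemma complement_nth_prime_unique:
  assumes "I \<subseteq> primes" "\<And>p. prime p \<Longrightarrow> p \<in> I \<longleftrightarrow> p \<notin> nth_prime ` I"
    and "J \<subseteq> primes" "\<And>p. prime p \<Longrightarrow> p \<in> J \<longleftrightarrow> p \<notin> nth_prime ` J"
  shows "I = J"
proof -
  have "p \<in> I \<longleftrightarrow> p \<in> J" for p
  proof (induction p rule: less_induct)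
    case (less p)
    then have "p \<in> nth_prime ` I \<longleftrightarrow> p \<in> nth_prime ` J"
      using less_nth_prime by blast
    then show ?case using assms by blast
  qed
  then show ?thesis by blast
qed

lemma primes_prime_eq: "primes_prime = odd_level_primes"
proof -
  \<comment> \<open>Covering and disjointness are the two directions of one pointwise
    equivalence.\<close>
  have iff: "(I \<subseteq> primes \<and> primes = I \<union> primes_indexed_by I \<and> I \<inter> primes_indexed_by I = {})
      \<longleftrightarrow> (I \<subseteq> primes \<and> (\<forall>p. prime p \<longrightarrow> (p \<in> I \<longleftrightarrow> p \<notin> nth_prime ` I)))" for I
    using prime_nth_prime unfolding primes_indexed_by_image by blast
  have sub: "odd_level_primes \<subseteq> primes" by (auto simp: odd_level_primes_def)
  show ?thesis
    unfolding primes_prime_def iff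
  proof (rule the_equality)
    show "odd_level_primes \<subseteq> primes \<and>
        (\<forall>p. prime p \<longrightarrow> (p \<in> odd_level_primes \<longleftrightarrow> p \<notin> nth_prime ` odd_level_primes))"
      using sub odd_level_primes_iff by blast
  next
    fix I
    assume "I \<subseteq> primes \<and> (\<forall>p. prime p \<longrightarrow> (p \<in> I \<longleftrightarrow> p \<notin> nth_prime ` I))"
    then show "I = odd_level_primes"
      using complement_nth_prime_unique[OF _ _ sub odd_level_primes_iff] by blast
  qed
qed

lemma alternating_union_iterated_primes:
  "alternating_union iterated_primes = odd_level_primes"
proof -
  have "p \<in> alternating_union iterated_primes \<longleftrightarrow> p \<in> odd_level_primes" for p
  proof (cases "prime p")
    case False
    then show ?thesis
      using iterated_primes_subset by (auto simp: alternating_union_def odd_level_primes_def)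
  next
    case True
    then obtain d where d: "d \<ge> 1" "levels p = {1..d}" using levels_initial_segment by blast
    have "p \<in> alternating_union iterated_primes \<longleftrightarrow>
        (\<exists>k\<in>levels p. odd k \<and> (\<forall>j\<in>levels p. j \<le> k))"
      by (auto simp: alternating_union_def levels_def)
    \<comment> \<open>The only possible witness is the maximum \<open>d\<close>, which is itself a
      level because \<open>d \<ge> 1\<close>.\<close>
    also have "\<dots> \<longleftrightarrow> odd d"
      unfolding d(2) using d(1) by (metis atLeastAtMost_iff le_antisym order_refl)
    \<comment> \<open>In \<open>{1..d}\<close> the largest level equals the number of
      levels.\<close>
    also have "\<dots> \<longleftrightarrow> p \<in> odd_level_primes"
      using True d by (simp add: odd_level_primes_def)
    finally show ?thesis .
  qed
  then show ?thesis by blast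
qed

theorem theorem2p1:
  "primes_prime = alternating_union iterated_primes
   \<and> primes_prime = {p \<in> primes. odd (card {k. k \<ge> 1 \<and> p \<in> iterated_primes k})}"
  using primes_prime_eq alternating_union_iterated_primes
  unfolding odd_level_primes_def levels_def by simp

end
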